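(* Let $d\ge2$, let $a_0,\dots,a_d\in R_n$ be linearly independent, and let $I=\langle a_0,\dots,a_d\rangle\subseteq R$ have $\boldsymbol{\mu}$-type $\boldsymbol{\mu}_{\min}=(1,\dots,1,n-d+1)$ (with $d-1$ ones), $n\ge d+1$. If the ancestor ideal of $I$ gives the partition $\mathcal{A}=(\alpha_1,\alpha_2)$ of $d+1$, then after a (linear) change of coordinates in $\mathbb{P}^d$, the curve parametrized by $(a_0,\dots,a_d)$ lies on the rational normal scroll $S_{\alpha_1-1,\alpha_2-1}$.
   Context: $\mathsf{k}$ is an arbitrary infinite field, $R=\mathsf{k}[s,t]$ with the standard grading, and $R_n$ is the space of homogeneous polynomials of degree $n$. For linearly independent $a_0,\dots,a_d\in R_n$ with $I=\langle a_0,\dots,a_d\rangle\subseteq R$, there is a graded exact sequence $0\to\bigoplus_{i=1}^d R(-n-\mu_i)\to R(-n)^{d+1}\xrightarrow{(a_0,\dots,a_d)} I\to 0$ with uniquely determined integers $1\le\mu_1\le\cdots\le\mu_d$; the tuple $(\mu_1,\dots,\mu_d)$ is called the $\boldsymbol{\mu}$-type of $(a_0,\dots,a_d)$ and of $I$; one has $\mu_1+\cdots+\mu_d=n-\deg\gcd(a_0,\dots,a_d)$. The ancestor ideal of $I$ is the largest homogeneous ideal of $R$ that equals $I$ in all degrees $\ge n$. It is known that if $I$ has $\boldsymbol{\mu}$-type $\boldsymbol{\mu}_{\min}$ and $n\ge d+1$, then the ancestor ideal equals $\langle h_1,h_2\rangle$ with $h_1,h_2$ relatively prime homogeneous and $I_n=R_{n-\deg(h_1)}\cdot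 h_1\oplus R_{n-\deg(h_2)}\cdot h_2$. Ordering so that $\deg(h_1)\ge\deg(h_2)$ and setting $\alpha_i=n+1-\deg(h_i)\ge1$ gives a partition $\mathcal{A}=(\alpha_1,\alpha_2)$ of $d+1$ with $\alpha_1\le\alpha_2$, called the partition given by the ancestor ideal. The rational normal scroll $S_{\alpha_1-1,\alpha_2-1}\subseteq\mathbb{P}^d$ consists of the points $\lambda\,(s^{\alpha_1-1},s^{\alpha_1-2}t,\dots,t^{\alpha_1-1},0,\dots,0)+\mu\,(0,\dots,0,s^{\alpha_2-1},s^{\alpha_2-2}t,\dots,t^{\alpha_2-1})$ for all $(s,t),(\lambda,\mu)\in\mathbb{P}^1$, where the first vector occupies the first $\alpha_1$ coordinates and the second the last $\alpha_2$ coordinates (when $\alpha_1=1$ the first vector is $(1,0,\dots,0)$). The parametrized curve is the image of $(s,t)\mapsto(a_0(s,t),\dots,a_d(s,t))$, $\mathbb{P}^1\to\mathbb{P}^d$. *)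

theory Defs
  imports
    "HOL-Computational_Algebra.Polynomial"
    "Jordan_Normal_Form.Matrix"
begin

text \<open>
  The ring \<open>R = k[s,t]\<close> is the type \<open>'k poly poly\<close>, read as \<open>k[s][t]\<close>: the coefficient of
  \<open>s^i t^j\<close> in \<open>p\<close> is \<open>coeff (coeff p j) i\<close>.
\<close>

definition hom_part :: "nat \<Rightarrow> 'k::comm_ring_1 poly poly set" where
  "hom_part n = {p. \<forall>i j. coeff (coeff p j) i \<noteq> 0 \<longrightarrow> i + j = n}"

definition eval_st :: "'k::comm_ring_1 poly poly \<Rightarrow> 'k \<Rightarrow> 'k \<Rightarrow> 'k" where
  "eval_st p s t = poly (poly p [:t:]) s"

definition lin_indep_family :: "nat \<Rightarrow> (nat \<Rightarrow> 'k::field poly poly) \<Rightarrow> bool" where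
  "lin_indep_family d a \<longleftrightarrow>
     inj_on a {..d} \<and> \<not> Modules.module.dependent (\<lambda>c. Polynomial.smult [:c:]) (a ` {..d})"

text \<open>Ideals are the submodules of a ring regarded as a module over itself.\<close>

definition ideal_gen :: "'r::comm_ring_1 set \<Rightarrow> 'r set" where
  "ideal_gen S = Modules.module.span (*) S"

lemma module_self: "Modules.module ((*) :: 'r::comm_ring_1 \<Rightarrow> 'r \<Rightarrow> 'r)"
  by unfold_locales (auto simp: algebra_simps)

lemma vector_space_R:
  "vector_space ((\<lambda>c. Polynomial.smult [:c:]) :: 'k::field \<Rightarrow> 'k poly poly \<Rightarrow> 'k poly poly)"
proof (rule vector_space.intro)
  fix a b :: 'k and x y :: "'k poly poly"
  show "Polynomial.smult [:a:] (x + y) = Polynomial.smult [:a:] x + Polynomial.smult [:a:] y"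
    by (rule Polynomial.smult_add_right)
  show "Polynomial.smult [:a + b:] x = Polynomial.smult [:a:] x + Polynomial.smult [:b:] x"
    by (simp flip: Polynomial.smult_add_left)
  show "Polynomial.smult [:a:] (Polynomial.smult [:b:] x) = Polynomial.smult [:a * b:] x"
    by (simp add: mult.commute)
  show "Polynomial.smult [:1:] x = x"
    by (simp flip: one_pCons)
qed

definition homogeneous_ideal :: "'k::comm_ring_1 poly poly set \<Rightarrow> bool" where
  "homogeneous_ideal J \<longleftrightarrow> (\<exists>S. S \<subseteq> (\<Union>m. hom_part m) \<and> J = ideal_gen S)"

text \<open>
  The graded exact sequence
  \<open>0 \<rightarrow> \<Oplus>\<^sub>i R(-n-\<mu>\<^sub>i) \<rightarrow> R(-n)^(d+1) \<rightarrow> I \<rightarrow> 0\<close>, whose second map is \<open>(a\<^sub>0, \<dots>, a\<^sub>d)\<close>.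
  The first map is multiplication by a matrix; being homogeneous of degree \<open>0\<close> for the indicated
  shifts means that the entries \<open>P i j\<close> for the \<open>i\<close>-th summand have degree \<open>\<mu>\<^sub>i\<close>.  The two further
  conjuncts are injectivity of this map and exactness in the middle; surjectivity onto
  \<open>I = ideal_gen (a ` {..d})\<close> holds by the definition of \<open>I\<close>.  The list is indexed from \<open>0\<close>.
\<close>

definition has_mu_type :: "nat \<Rightarrow> (nat \<Rightarrow> 'k::field poly poly) \<Rightarrow> nat list \<Rightarrow> bool" where
  "has_mu_type d a \<mu> \<longleftrightarrow>
     length \<mu> = d \<and> sorted \<mu> \<and> (\<forall>m\<in>set \<mu>. 1 \<le> m) \<and>
     (\<exists>P. (\<forall>i<d. \<forall>j\<le>d. P i j \<in> hom_part (\<mu> ! i)) \<and>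
          (\<forall>q. (\<forall>j\<le>d. (\<Sum>i<d. q i * P i j) = 0) \<longrightarrow> (\<forall>i<d. q i = 0)) \<and>
          (\<forall>b. (\<Sum>j\<le>d. b j * a j) = 0 \<longleftrightarrow> (\<exists>q. \<forall>j\<le>d. b j = (\<Sum>i<d. q i * P i j))))"

definition mu_min :: "nat \<Rightarrow> nat \<Rightarrow> nat list" where
  "mu_min d n = replicate (d - 1) 1 @ [n - d + 1]"

definition agrees_from :: "nat \<Rightarrow> 'k::comm_ring_1 poly poly set \<Rightarrow> 'k poly poly set \<Rightarrow> bool" where
  "agrees_from n I J \<longleftrightarrow> (\<forall>m\<ge>n. J \<inter> hom_part m = I \<inter> hom_part m)"

definition is_ancestor_ideal :: "nat \<Rightarrow> 'k::comm_ring_1 poly poly set \<Rightarrow> 'k poly poly set \<Rightarrow> bool"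
where
  "is_ancestor_ideal n I J \<longleftrightarrow>
     homogeneous_ideal J \<and> agrees_from n I J \<and>
     (\<forall>J'. homogeneous_ideal J' \<and> agrees_from n I J' \<longrightarrow> J' \<subseteq> J)"

text \<open>
  Here \<open>e\<^sub>i = deg h\<^sub>i\<close> and \<open>\<alpha>\<^sub>i = n + 1 - e\<^sub>i\<close>, written without subtraction.  That
  \<open>\<alpha>\<^sub>1, \<alpha>\<^sub>2 \<ge> 1\<close>, that \<open>\<alpha>\<^sub>1 + \<alpha>\<^sub>2 = d + 1\<close> and that
  \<open>I\<^sub>n = R\<^bsub>n-e\<^sub>1\<^esub> h\<^sub>1 \<oplus> R\<^bsub>n-e\<^sub>2\<^esub> h\<^sub>2\<close>
  are consequences when \<open>I\<close> has type \<open>mu_min\<close> and \<open>n \<ge> d + 1\<close>, and so are not required here.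
\<close>

definition ancestor_partition ::
  "nat \<Rightarrow> 'k::field poly poly set \<Rightarrow> nat \<Rightarrow> nat \<Rightarrow> bool" where
  "ancestor_partition n I \<alpha>\<^sub>1 \<alpha>\<^sub>2 \<longleftrightarrow>
     (\<exists>h\<^sub>1 h\<^sub>2 e\<^sub>1 e\<^sub>2.
        h\<^sub>1 \<in> hom_part e\<^sub>1 \<and> h\<^sub>1 \<noteq> 0 \<and> h\<^sub>2 \<in> hom_part e\<^sub>2 \<and> h\<^sub>2 \<noteq> 0 \<and> coprime h\<^sub>1 h\<^sub>2 \<and>
        is_ancestor_ideal n I (ideal_gen {h\<^sub>1, h\<^sub>2}) \<and>
        e\<^sub>1 \<ge> e\<^sub>2 \<and> \<alpha>\<^sub>1 + e\<^sub>1 = n + 1 \<and> \<alpha>\<^sub>2 + e\<^sub>2 = n + 1)"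

text \<open>
  The point of projective space with homogeneous coordinates \<open>v \<noteq> 0\<close> is the set of all nonzero
  multiples of \<open>v\<close>.  For \<open>v = 0\<close> the result \<open>{0}\<close> is not the class of any nonzero vector.
\<close>

definition proj_point :: "'k::field vec \<Rightarrow> 'k vec set" where
  "proj_point v = {c \<cdot>\<^sub>v v | c. c \<noteq> 0}"

definition proj_map :: "'k::field mat \<Rightarrow> 'k vec set \<Rightarrow> 'k vec set" where
  "proj_map A p = (\<lambda>v. A *\<^sub>v v) ` p"

definition param_curve :: "nat \<Rightarrow> (nat \<Rightarrow> 'k::field poly poly) \<Rightarrow> 'k vec set set" where
  "param_curve d a =
     {proj_point (vec (d + 1) (\<lambda>j. eval_st (a j) s t)) | s t. (s, t) \<noteq> (0, 0)}"

text \<open>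
  The scroll \<open>S\<^bsub>e,f\<^esub>\<close> in \<open>P^(e+f+1)\<close>.  The first \<open>e + 1\<close> coordinates are
  \<open>l * (s^e, s^(e-1) t, \<dots>, t^e)\<close>, the last \<open>f + 1\<close> are \<open>m * (s^f, s^(f-1) t, \<dots>, t^f)\<close>;
  for \<open>e = 0\<close> the first block is \<open>l\<close> since \<open>0 ^ 0 = 1\<close>.
\<close>

definition scroll_vec :: "nat \<Rightarrow> nat \<Rightarrow> 'k::field \<Rightarrow> 'k \<Rightarrow> 'k \<Rightarrow> 'k \<Rightarrow> 'k vec" where
  "scroll_vec e f s t l m =
     vec ((e + 1) + (f + 1))
       (\<lambda>j. if j < e + 1 then l * (s ^ (e - j) * t ^ j)
            else m * (s ^ (f - (j - (e + 1))) * t ^ (j - (e + 1))))"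

definition rational_normal_scroll :: "nat \<Rightarrow> nat \<Rightarrow> 'k::field vec set set" where
  "rational_normal_scroll e f =
     {proj_point (scroll_vec e f s t l m) | s t l m. (s, t) \<noteq> (0, 0) \<and> (l, m) \<noteq> (0, 0)}"

end

theory Submission
  imports Defs
begin

text \<open>
  Write \<open>J = \<langle>h\<^sub>1, h\<^sub>2\<rangle>\<close> for the ancestor ideal, with \<open>deg h\<^sub>i = e\<^sub>i\<close>, so that
  \<open>J\<^sub>n = I\<^sub>n\<close> has dimension \<open>d + 1 < n + 1 = dim R\<^sub>n\<close>.  If \<open>e\<^sub>1 = n + 1\<close>, then \<open>h\<^sub>2\<close> divides
  \<open>I\<close> and hence \<open>h\<^sub>1 \<in> J\<^bsub>n+1\<^esub> = I\<^bsub>n+1\<^esub>\<close>, so \<open>h\<^sub>2\<close> is a unit and \<open>J\<^sub>n = R\<^sub>n\<close>; if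
  \<open>e\<^sub>1 + e\<^sub>2 \<le> n\<close>, then \<open>J\<^sub>n = R\<^sub>n\<close> as well.  Both are impossible.  Otherwise the smallest syzygy of
  \<open>h\<^sub>1, h\<^sub>2\<close> has degree \<open>e\<^sub>1 + e\<^sub>2 > n\<close>, so the products of \<open>h\<^sub>i\<close> with the monomials of degree
  \<open>n - e\<^sub>i\<close> form a basis of \<open>I\<^sub>n\<close>.  The change of basis from the \<open>a\<^sub>j\<close> to this basis is the
  required change of coordinates: at \<open>(s, t)\<close> the new basis takes the value of the scroll point with
  parameters \<open>\<lambda> = h\<^sub>1(s, t)\<close> and \<open>\<mu> = h\<^sub>2(s, t)\<close>, which do not both vanish.

  Statements on forms are reduced to \<open>k[t]\<close> by setting \<open>s = 1\<close>.
\<close>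

section \<open>Families of vectors\<close>

context Modules.module
begin

text \<open>Coefficients are attached to indices rather than to vectors, so repeated members do no
  harm: adding \<open>scale k (b j)\<close> changes only the coefficient at
  \<open>j\<close>.\<close>

lemma span_image_family:
  assumes "finite X"
  shows "span (b ` X) = {\<Sum>i\<in>X. scale (c i) (b i) | c. True}"
proof
  show "span (b ` X) \<subseteq> {\<Sum>i\<in>X. scale (c i) (b i) | c. True}"
  proof
    fix v assume "v \<in> span (b ` X)"
    then show "v \<in> {\<Sum>i\<in>X. scale (c i) (b i) | c. True}"
    proof (induction rule: span_induct_alt)
      case base
      show ?case by (auto intro!: exI[of _ "\<lambda>_. 0"])
    next
      case (step k x y)
      then obtain j c where "j \<in> X" "x = b j" "y = (\<Sum>i\<in>X. scale (c i) (b i))"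
        by auto
      then have "scale k x + y = (\<Sum>i\<in>X. scale ((if i = j then k else 0) + c i) (b i))"
        using assms by (simp add: scale_left_distrib sum.distrib if_distrib[of "\<lambda>c. scale c _"]
            sum.delta cong: if_cong)
      then show ?case by (intro CollectI exI conjI TrueI)
    qed
  qed
qed (auto intro!: span_sum intro: span_scale span_base)

end

context vector_space
begin

text \<open>Dependence of the image set cannot see repetitions. Injectivity restores them, so the
  pair of conditions used in \<open>lin_indep_family\<close> becomes a statement about
  coefficients.\<close>

lemma independent_family_iff:
  assumes "finite X"
  shows "inj_on b X \<and> \<not> dependent (b ` X) \<longleftrightarrow>
    (\<forall>c. (\<Sum>i\<in>X. scale (c i) (b i)) = 0 \<longrightarrow> (\<forall>i\<in>X. c i = 0))" (is "?L \<longleftrightarrow> ?R")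
proof
  assume L: ?L
  show ?R
  proof (intro allI impI ballI)
    fix c i assume z: "(\<Sum>i\<in>X. scale (c i) (b i)) = 0" and i: "i \<in> X"
    let ?g = "\<lambda>v. c (the_inv_into X b v)"
    have "(\<Sum>v\<in>b ` X. scale (?g v) v) = (\<Sum>i\<in>X. scale (?g (b i)) (b i))"
      using L by (simp add: sum.reindex)
    also have "\<dots> = 0"
      using L by (subst z[symmetric]) (rule sum.cong, auto simp: the_inv_into_f_f)
    finally have "?g (b i) = 0"
      using independentD[of "b ` X" "b ` X" ?g "b i"] L i assms by auto
    then show "c i = 0"
      using L i by (simp add: the_inv_into_f_f)
  qed
next
  assume R: ?R
  have inj: "inj_on b X"
  proof (rule inj_onI, rule ccontr)
    fix i j assume ij: "i \<in> X" "j \<in> X" "b i = b j" "i \<noteq> j"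
    \<comment> \<open>Two equal members would satisfy the relation with coefficients 1 and
      -1.\<close>
    let ?c = "\<lambda>k. if k = i then 1 :: 'a else if k = j then - 1 else 0"
    have "(\<Sum>k\<in>X. scale (?c k) (b k)) = (\<Sum>k\<in>{i, j}. scale (?c k) (b k))"
      using ij assms by (intro sum.mono_neutral_right) auto
    also have "\<dots> = 0" using ij by simp
    finally have "?c i = 0" using spec[OF R, of ?c] ij(1) by blast
    then show False by simp
  qed
  moreover have "\<not> dependent (b ` X)"
  proof (rule independent_if_scalars_zero)
    show "finite (b ` X)" using assms by simp
    fix f x assume z: "(\<Sum>x\<in>b ` X. scale (f x) x) = 0" and x: "x \<in> b ` X"
    have "(\<Sum>i\<in>X. scale (f (b i)) (b i)) = 0"
      using z inj by (simp add: sum.reindex)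
    then show "f x = 0" using spec[OF R, of "\<lambda>i. f (b i)"] x by auto
  qed
  ultimately show ?L by simp
qed

lemma dim_span_family:
  assumes "finite X" "\<forall>c. (\<Sum>i\<in>X. scale (c i) (b i)) = 0 \<longrightarrow> (\<forall>i\<in>X. c i = 0)"
  shows "dim (span (b ` X)) = card X"
proof -
  have "inj_on b X \<and> \<not> dependent (b ` X)"
    using assms by (simp only: independent_family_iff)
  then show ?thesis
    by (simp add: dim_eq_card_independent card_image)
qed

text \<open>Substituting one expansion into the other writes each \<open>a i\<close> in terms of the
  family \<open>a\<close>; independence forces the coefficients to be Kronecker deltas. Exchanging
  the roles of \<open>a\<close> and \<open>b\<close> gives the product in the other order.\<close>

lemma inverse_change_of_basis:
  assumes ind: "\<forall>c. (\<Sum>i<N. scale (c i) (a i)) = 0 \<longrightarrow> (\<forall>i\<in>{..<N}. c i = 0)"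
    and A: "\<And>i. i < N \<Longrightarrow> a i = (\<Sum>j<N. scale (A i j) (b j))"
    and B: "\<And>j. j < N \<Longrightarrow> b j = (\<Sum>k<N. scale (B j k) (a k))"
  shows "mat N N (\<lambda>(i, j). A i j) * mat N N (\<lambda>(i, j). B i j) = 1\<^sub>m N"
proof (rule eq_matI)
  fix i k assume ik: "i < dim_row (1\<^sub>m N)" "k < dim_col (1\<^sub>m N)"
  let ?C = "\<lambda>k. \<Sum>j<N. A i j * B j k"
  have "a i = (\<Sum>j<N. \<Sum>k<N. scale (A i j * B j k) (a k))"
    using ik by (subst A) (auto simp: B scale_sum_right intro!: sum.cong)
  also have "\<dots> = (\<Sum>k<N. scale (?C k) (a k))"
    by (subst sum.swap) (simp add: scale_sum_left)
  finally have "(\<Sum>k<N. scale (?C k) (a k)) = a i" ..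
  moreover have "(\<Sum>k<N. scale (if k = i then 1 else 0) (a k)) =
      (\<Sum>k<N. if k = i then a k else 0)"
    by (intro sum.cong) auto
  ultimately have "(\<Sum>k<N. scale (?C k - (if k = i then 1 else 0)) (a k)) = 0"
    using ik by (simp add: scale_left_diff_distrib sum_subtractf)
  from ind[rule_format, OF this, of k] have "?C k = (if k = i then 1 else 0)"
    using ik by simp
  then show "(mat N N (\<lambda>(i, j). A i j) * mat N N (\<lambda>(i, j). B i j)) $$ (i, k) = 1\<^sub>m N $$ (i, k)"
    using ik by (simp add: scalar_prod_def atLeast0LessThan)
qed auto

lemma change_of_basis:
  assumes inda: "\<forall>c. (\<Sum>i<N. scale (c i) (a i)) = 0 \<longrightarrow> (\<forall>i\<in>{..<N}. c i = 0)"
    and indb: "\<forall>c. (\<Sum>i<N. scale (c i) (b i)) = 0 \<longrightarrow> (\<forall>i\<in>{..<N}. c i = 0)"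
    and span: "span (a ` {..<N}) = span (b ` {..<N})"
  obtains M where "M \<in> carrier_mat N N" "invertible_mat M"
    "\<And>i. i < N \<Longrightarrow> b i = (\<Sum>j<N. scale (M $$ (i, j)) (a j))"
proof -
  have "\<exists>c. a i = (\<Sum>j<N. scale (c j) (b j))" if "i < N" for i
    using span_base[of "a i" "a ` {..<N}"] that unfolding span by (auto simp: span_image_family)
  then obtain A where A: "\<And>i. i < N \<Longrightarrow> a i = (\<Sum>j<N. scale (A i j) (b j))" by metis
  have "\<exists>c. b i = (\<Sum>j<N. scale (c j) (a j))" if "i < N" for i
    using span_base[of "b i" "b ` {..<N}"] that unfolding span[symmetric] by (auto simp: span_image_family)
  then obtain B where B: "\<And>i. i < N \<Longrightarrow> b i = (\<Sum>j<N. scale (B i j) (a j))" by metis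
  let ?M = "mat N N (\<lambda>(i, j). B i j)"
  have "invertible_mat ?M"
    using inverse_change_of_basis[of a N A b B, OF inda A B]
      inverse_change_of_basis[of b N B a A, OF indb B A]
    unfolding invertible_mat_def inverts_mat_def by auto
  then show thesis using that[of ?M] B by simp
qed

end

section \<open>The Bezout identity for univariate polynomials\<close>

text \<open>Euclid's algorithm: a common divisor of \<open>g\<close> and \<open>f mod g\<close> also
  divides \<open>f\<close>, and its expression in these two is rewritten in \<open>f\<close> and
  \<open>g\<close>.\<close>

lemma field_poly_bezout:
  fixes f g :: "'k::field poly"
  obtains u v where "u * f + v * g dvd f" "u * f + v * g dvd g"
proof -
  have "\<exists>u v. u * f + v * g dvd f \<and> u * f + v * g dvd g"
  \<comment> \<open>The measure is 0 only for the zero polynomial, so a zero remainder counts as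
    smaller than a nonzero constant divisor.\<close>
  proof (induction "if g = 0 then 0 else Suc (degree g)" arbitrary: f g rule: less_induct)
    case less
    show ?case
    proof (cases "g = 0")
      case True
      then show ?thesis by (intro exI[of _ 1] exI[of _ 0]) simp
    next
      case False
      then have "(if f mod g = 0 then 0 else Suc (degree (f mod g))) < (if g = 0 then 0 else Suc (degree g))"
        using degree_mod_less[of g f] by auto
      from less[OF this] obtain u v where uv: "u * g + v * (f mod g) dvd g" "u * g + v * (f mod g) dvd f mod g"
        by blast
      have "u * g + v * (f mod g) = v * f + (u - v * (f div g)) * g"
        by (simp add: minus_div_mult_eq_mod[symmetric] algebra_simps)
      moreover have "u * g + v * (f mod g) dvd f"
        using uv by (simp add: dvd_mod_iff)
      ultimately show ?thesis using uv(1) by metis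
    qed
  qed
  then show thesis using that by blast
qed

section \<open>Homogeneous polynomials\<close>

text \<open>The homogenization \<open>s^m f(t/s)\<close>, if \<open>degree f \<le> m\<close>; higher terms of \<open>f\<close> are dropped.\<close>

definition homog :: "nat \<Rightarrow> 'k::comm_ring_1 poly \<Rightarrow> 'k poly poly" where
  "homog m f = (\<Sum>j\<le>m. monom (monom (coeff f j) (m - j)) j)"

lemma coeff_homog: "coeff (homog m f) j = (if j \<le> m then monom (coeff f j) (m - j) else 0)"
  by (simp add: homog_def coeff_sum)

lemma coeff_homog_le:
  "degree f \<le> m \<Longrightarrow> coeff (homog m f) j = monom (coeff f j) (m - j)"
  by (auto simp: coeff_homog coeff_eq_0)

lemma homog_in_hom_part: "homog m f \<in> hom_part m"
  by (auto simp: hom_part_def coeff_homog split: if_splits)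

text \<open>The witness is \<open>p\<close> at s = 1; nothing is lost, since in a form of degree
  \<open>m\<close> the power of t determines that of s.\<close>

lemma hom_partE:
  assumes "p \<in> hom_part m"
  obtains f where "degree f \<le> m" "p = homog m f"
proof -
  let ?f = "\<Sum>j\<le>m. monom (coeff (coeff p j) (m - j)) j"
  have c: "coeff ?f j = (if j \<le> m then coeff (coeff p j) (m - j) else 0)" for j
    by (auto simp: coeff_sum)
  have "degree ?f \<le> m" by (rule degree_le) (simp only: c, simp)
  moreover have "p = homog m ?f"
  proof (intro poly_eqI)
    fix j i
    have "coeff (coeff p j) i = 0" if "i + j \<noteq> m"
      using assms that by (auto simp: hom_part_def)
    then show "coeff (coeff p j) i = coeff (coeff (homog m ?f) j) i"
      by (simp only: coeff_homog c) auto
  qed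
  ultimately show thesis using that by blast
qed

lemma homog_0 [simp]: "homog m 0 = 0"
  by (simp add: homog_def)

lemma homog_add: "homog m (f + g) = homog m f + homog m g"
  by (intro poly_eqI) (simp add: coeff_homog)

lemma homog_eq_0_iff: "degree f \<le> m \<Longrightarrow> homog m f = 0 \<longleftrightarrow> f = 0"
  by (metis coeff_0 coeff_homog_le homog_0 monom_eq_0_iff poly_eqI)

text \<open>The powers of s add up as they should unless a subtraction of exponents is truncated; in
  that case the degree bounds make a coefficient vanish.\<close>

lemma homog_mult:
  assumes "degree f \<le> m" "degree g \<le> n"
  shows "homog m f * homog n g = homog (m + n) (f * g)"
proof (rule poly_eqI)
  fix j
  have "degree (f * g) \<le> m + n"
    using degree_mult_le[of f g] assms by linarith
  then have "coeff (homog (m + n) (f * g)) j = (\<Sum>i\<le>j. monom (coeff f i * coeff g (j - i)) (m + n - j))"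
    by (simp add: coeff_homog_le coeff_mult monom_sum)
  moreover have "monom (coeff f i) (m - i) * monom (coeff g (j - i)) (n - (j - i)) =
      monom (coeff f i * coeff g (j - i)) (m + n - j)" if "i \<le> j" for i
  proof (cases "i \<le> m \<and> j - i \<le> n")
    case True
    then have "m - i + (n - (j - i)) = m + n - j" using that by auto
    then show ?thesis by (simp add: mult_monom)
  next
    case False
    then have "coeff f i = 0 \<or> coeff g (j - i) = 0"
      using assms by (auto simp: coeff_eq_0)
    then show ?thesis by auto
  qed
  ultimately show "coeff (homog m f * homog n g) j = coeff (homog (m + n) (f * g)) j"
    using assms by (simp add: coeff_mult[of "homog m f"] coeff_homog_le)
qed

lemma hom_part_0 [simp]: "0 \<in> hom_part m"
  by (simp add: hom_part_def)

lemma hom_part_add: "p \<in> hom_part m \<Longrightarrow> q \<in> hom_part m \<Longrightarrow> p + q \<in> hom_part m"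
  unfolding hom_part_def mem_Collect_eq by (metis coeff_add add.right_neutral add_0)

lemma hom_part_smult: "p \<in> hom_part m \<Longrightarrow> Polynomial.smult [:c:] p \<in> hom_part m"
  unfolding hom_part_def by (simp, metis mult_zero_right)

lemma hom_part_sum: "(\<And>i. i \<in> X \<Longrightarrow> f i \<in> hom_part m) \<Longrightarrow> (\<Sum>i\<in>X. f i) \<in> hom_part m"
  by (induction X rule: infinite_finite_induct) (auto intro: hom_part_add)

lemma hom_part_mult:
  assumes "p \<in> hom_part m" "q \<in> hom_part n"
  shows "p * q \<in> hom_part (m + n)"
proof -
  obtain f g where "degree f \<le> m" "p = homog m f" "degree g \<le> n" "q = homog n g"
    using assms by (metis hom_partE)
  then show ?thesis by (simp add: homog_mult homog_in_hom_part)
qed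

lemma hom_part_0_const:
  assumes "p \<in> hom_part 0"
  obtains c where "p = [:[:c:]:]"
  using assms by (elim hom_partE) (auto simp: homog_def monom_0)

section \<open>Homogeneous components\<close>

definition hom_comp :: "nat \<Rightarrow> 'k::comm_ring_1 poly poly \<Rightarrow> 'k poly poly" where
  "hom_comp m p = (\<Sum>j\<le>m. monom (monom (coeff (coeff p j) (m - j)) (m - j)) j)"

lemma coeff_hom_comp:
  "coeff (coeff (hom_comp m p) j) i = (if i + j = m then coeff (coeff p j) i else 0)"
  by (auto simp: hom_comp_def coeff_sum)

lemma hom_comp_in_hom_part: "hom_comp m p \<in> hom_part m"
  by (simp add: hom_part_def coeff_hom_comp)

lemma hom_comp_add: "hom_comp m (p + q) = hom_comp m p + hom_comp m q"
  by (intro poly_eqI) (simp add: coeff_hom_comp)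

lemma hom_comp_0 [simp]: "hom_comp m 0 = 0"
  by (intro poly_eqI) (simp add: coeff_hom_comp)

lemma hom_comp_sum: "hom_comp m (\<Sum>i\<in>X. f i) = (\<Sum>i\<in>X. hom_comp m (f i))"
  by (induction X rule: infinite_finite_induct) (auto simp: hom_comp_add)

lemma hom_comp_hom_part:
  assumes "p \<in> hom_part n"
  shows "hom_comp m p = (if m = n then p else 0)"
  using assms by (intro poly_eqI) (auto simp: coeff_hom_comp hom_part_def)

text \<open>All large \<open>M\<close> are allowed because \<open>hom_comp_mult\<close> has to
  choose \<open>M\<close> above the degree \<open>n\<close> as well.\<close>

lemma sum_hom_comp:
  obtains N where "\<And>M. N \<le> M \<Longrightarrow> p = (\<Sum>m\<le>M. hom_comp m p)"
proof -
  define N where "N = degree p + Max ((\<lambda>j. degree (coeff p j)) ` {..degree p})"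
  have "i + j \<le> N" if "coeff (coeff p j) i \<noteq> 0" for i j
  proof -
    have "j \<le> degree p" using that by (metis coeff_0 le_degree)
    moreover have "i \<le> degree (coeff p j)" using that by (rule le_degree)
    ultimately have "i \<le> Max ((\<lambda>j. degree (coeff p j)) ` {..degree p})"
      by (auto intro!: order_trans[OF _ Max_ge])
    with \<open>j \<le> degree p\<close> show ?thesis by (simp add: N_def)
  qed
  then have "p = (\<Sum>m\<le>M. hom_comp m p)" if "N \<le> M" for M
    using that by (intro poly_eqI) (fastforce simp: coeff_sum coeff_hom_comp)
  then show thesis using that by blast
qed

lemma hom_comp_mult:
  assumes h: "h \<in> hom_part e"
  shows "hom_comp n (x * h) = (if e \<le> n then hom_comp (n - e) x * h else 0)"
proof -
  obtain M where M: "x = (\<Sum>m\<le>M. hom_comp m x)" "n \<le> M"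
    by (metis sum_hom_comp max.cobounded1 max.cobounded2)
  have "hom_comp n (x * h) = (\<Sum>m\<le>M. hom_comp n (hom_comp m x * h))"
    by (subst M(1)) (simp add: sum_distrib_right hom_comp_sum)
  also have "\<dots> = (\<Sum>m\<le>M. if n = m + e then hom_comp m x * h else 0)"
    by (intro sum.cong refl hom_comp_hom_part hom_part_mult hom_comp_in_hom_part h)
  \<comment> \<open>Solving for \<open>m\<close> isolates a single summand; the guard
    \<open>e \<le> n\<close> rules out a truncated difference, and \<open>n \<le> M\<close> puts the
    index in range.\<close>
  also have "\<dots> = (\<Sum>m\<le>M. if m = n - e then (if e \<le> n then hom_comp m x * h else 0) else 0)"
    by (intro sum.cong) auto
  also have "\<dots> = (if e \<le> n then hom_comp (n - e) x * h else 0)"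
    using M(2) by (auto simp del: if_distrib)
  finally show ?thesis .
qed

section \<open>Values of forms at points\<close>

lemma eval_st_mult: "eval_st (p * q) s t = eval_st p s t * eval_st q s t"
  by (simp add: eval_st_def)

lemma eval_st_sum: "eval_st (\<Sum>i\<in>X. f i) s t = (\<Sum>i\<in>X. eval_st (f i) s t)"
  by (simp add: eval_st_def poly_sum)

lemma eval_st_smult: "eval_st (Polynomial.smult [:c:] p) s t = c * eval_st p s t"
  by (simp add: eval_st_def)

lemma eval_st_monom: "eval_st (monom (monom c i) j) s t = c * (s ^ i * t ^ j)"
  by (simp add: eval_st_def poly_monom poly_power)

lemma eval_st_homog: "eval_st (homog m f) s t = (\<Sum>j\<le>m. coeff f j * (s ^ (m - j) * t ^ j))"
  by (simp add: homog_def eval_st_sum eval_st_monom)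

lemma eval_st_homog_nonzero:
  fixes f :: "'k::field poly"
  assumes "degree f \<le> m" "s \<noteq> 0"
  shows "eval_st (homog m f) s t = s ^ m * poly f (t / s)"
proof -
  have "poly f (t / s) = (\<Sum>j\<le>m. coeff f j * (t / s) ^ j)"
    unfolding poly_altdef by (rule sum.mono_neutral_left) (use assms in \<open>auto simp: coeff_eq_0\<close>)
  then show ?thesis
    using assms by (auto simp: eval_st_homog sum_distrib_left power_diff field_simps intro!: sum.cong)
qed

text \<open>Every term other than the top one carries a positive power of s; the top one survives
  through \<open>0 ^ 0 = 1\<close>.\<close>

lemma eval_st_homog_zero: "eval_st (homog m f) 0 t = coeff f m * t ^ m"
proof -
  have "eval_st (homog m f) 0 t = (\<Sum>j\<le>m. if j = m then coeff f j * t ^ j else 0)"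
    unfolding eval_st_homog by (intro sum.cong) (auto simp: power_0_left)
  then show ?thesis by simp
qed

section \<open>Coprime homogeneous polynomials\<close>

text \<open>A unit is a nonzero constant, while the coefficient of t^0 is a multiple of s^m.\<close>

lemma homog_dvd_1:
  fixes f :: "'k::field poly"
  assumes "degree f \<le> m" "homog m f dvd 1"
  shows "m = 0"
proof -
  obtain c where c: "homog m f = [:[:c:]:]" "c \<noteq> 0"
    using assms(2) by (metis is_unit_poly_iff dvd_0_left_iff zero_neq_one)
  then have "monom (coeff f 0) m = [:c:]"
    using assms(1) by (metis coeff_homog_le coeff_pCons_0 diff_zero)
  then show ?thesis using c by (auto simp: monom_eq_const_iff)
qed

text \<open>The two conclusions are coprimality in the chart s = 1 and at the point s = 0. A common
  divisor of \<open>f\<close> and \<open>g\<close> homogenizes to one of the forms, so it is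
  constant; if both degrees dropped, s would divide both forms.\<close>

lemma coprime_homog:
  fixes f g :: "'k::field poly"
  assumes "degree f \<le> m" "degree g \<le> n" "f \<noteq> 0"
    and cop: "coprime (homog m f) (homog n g)"
  shows "\<exists>u v. u * f + v * g = 1" and "degree f = m \<or> degree g = n"
proof -
  obtain u v where uv: "u * f + v * g dvd f" "u * f + v * g dvd g"
    by (rule field_poly_bezout)
  define D where "D = u * f + v * g"
  obtain f' g' where fg: "f = D * f'" "g = D * g'"
    using uv unfolding D_def[symmetric] by (metis dvdE)
  have "D \<noteq> 0" using fg assms by auto
  have dvd: "homog (degree D) D dvd homog k (D * h)" if "degree (D * h) \<le> k" for k h
  proof (cases "h = 0")
    case False
    then have "degree (D * h) = degree D + degree h"
      using \<open>D \<noteq> 0\<close> by (simp add: degree_mult_eq)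
    then have "homog (degree D) D * homog (k - degree D) h = homog k (D * h)"
      using that by (subst homog_mult) auto
    then show ?thesis by (metis dvd_triv_left)
  qed simp
  have "homog (degree D) D dvd 1"
    using dvd[of f' m] dvd[of g' n] assms(1,2) fg cop by (metis coprime_common_divisor)
  then have "degree D = 0" by (intro homog_dvd_1[of D]) auto
  then obtain c where c: "D = [:c:]" by (rule degree_eq_zeroE)
  then have "c \<noteq> 0" using \<open>D \<noteq> 0\<close> by auto
  then have "([:inverse c:] * u) * f + ([:inverse c:] * v) * g = 1"
    using c by (simp add: D_def mult.assoc smult_add_right[symmetric] one_pCons)
  then show "\<exists>u v. u * f + v * g = 1" by blast
  show "degree f = m \<or> degree g = n"
  proof (rule ccontr)
    assume "\<not> ?thesis"
    then have lt: "degree f < m" "degree g < n" using assms by auto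
    \<comment> \<open>\<open>homog 1 1\<close> is the form \<open>s\<close>.\<close>
    have s_dvd: "homog 1 1 dvd homog k h" if "degree h < k" for k and h :: "'k poly"
    proof -
      have "homog 1 1 * homog (k - 1) h = homog k h"
        using that by (subst homog_mult) auto
      then show ?thesis by (metis dvd_triv_left)
    qed
    have "homog 1 (1 :: 'k poly) dvd 1"
      using s_dvd[OF lt(1)] s_dvd[OF lt(2)] cop by (metis coprime_common_divisor)
    then have "1 = (0 :: nat)" by (rule homog_dvd_1[rotated]) simp
    then show False by simp
  qed
qed

lemma bezout_dvd:
  fixes f g p :: "'k::field poly"
  assumes "u * f + v * g = 1" "f dvd p * g"
  shows "f dvd p"
proof -
  have "p = p * (u * f + v * g)" unfolding assms(1) by simp
  also have "\<dots> = (p * u) * f + v * (p * g)" by (simp add: algebra_simps)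
  also have "f dvd \<dots>" by (intro dvd_add dvd_mult[OF assms(2)] dvd_triv_right)
  finally show ?thesis .
qed

text \<open>By the Bezout identity every syzygy is \<open>x = - (g * w)\<close>,
  \<open>y = f * w\<close>. Since \<open>f\<close> or \<open>g\<close> attains its full degree, a
  nonzero \<open>w\<close> violates one of the degree bounds.\<close>

lemma coprime_homog_syzygy:
  fixes f g :: "'k::field poly"
  assumes "degree f \<le> m" "degree g \<le> n" "f \<noteq> 0" "g \<noteq> 0"
    and cop: "coprime (homog m f) (homog n g)"
    and eq: "x * f + y * g = 0" and deg: "degree x + m < m + n" "degree y + n < m + n"
  shows "x = 0 \<and> y = 0"
proof -
  obtain u v where uv: "u * f + v * g = 1"
    using coprime_homog(1)[OF assms(1-3) cop] by blast
  have y: "y * g = - (x * f)" using eq by (simp add: eq_neg_iff_add_eq_0 add.commute)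
  have "f dvd y * g" unfolding y by simp
  then have "f dvd y" by (rule bezout_dvd[OF uv])
  then obtain w where w: "y = f * w" by (elim dvdE)
  then have "f * (x + g * w) = 0" using eq by (simp add: algebra_simps)
  then have "x = - (g * w)" using assms(3) by (simp add: eq_neg_iff_add_eq_0)
  moreover have "w = 0"
  proof (rule ccontr)
    assume "w \<noteq> 0"
    then have "degree y = degree f + degree w" "degree x = degree g + degree w"
      using assms(3,4) w \<open>x = _\<close> by (simp_all add: degree_mult_eq)
    then show False using coprime_homog(2)[OF assms(1-3) cop] deg by linarith
  qed
  ultimately show ?thesis using w by simp
qed

text \<open>Multiply the Bezout identity by \<open>h\<close> and reduce the second coefficient
  modulo \<open>f\<close>. Then \<open>y * g\<close> fits into degree \<open>N\<close>, hence so
  does \<open>x * f\<close>, and the exact degree of \<open>f\<close> turns this into a bound on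
  \<open>x\<close>.\<close>

lemma homog_combination:
  fixes f g :: "'k::field poly"
  assumes f: "degree f = m" "f \<noteq> 0" and g: "degree g \<le> n" and uv: "u * f + v * g = 1"
    and N: "m + n \<le> N" "degree h \<le> N"
  obtains x y where "h = x * f + y * g" "degree x \<le> N - m" "degree y \<le> N - n"
proof -
  define y where "y = (h * v) mod f"
  define x where "x = h * u + ((h * v) div f) * g"
  have "h = h * (u * f + v * g)" using uv by simp
  also have "\<dots> = h * u * f + (((h * v) div f) * f + y) * g"
    by (simp add: y_def algebra_simps)
  also have "\<dots> = x * f + y * g" by (simp add: x_def algebra_simps)
  finally have eq: "h = x * f + y * g" .
  have y: "y = 0 \<or> degree y < m" using degree_mod_less[of f] f by (auto simp: y_def)
  then have "degree (y * g) \<le> N"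
    using N g degree_mult_le[of y g] by fastforce
  then have "degree (x * f) \<le> N"
    using eq N by (metis add_diff_cancel_right' degree_diff_le)
  then have "degree x \<le> N - m"
    using f by (cases "x = 0") (auto simp: degree_mult_eq)
  moreover have "degree y \<le> N - n" using y N by auto
  ultimately show thesis using eq that by blast
qed

text \<open>For s = 0 one of the top coefficients is nonzero; elsewhere the Bezout identity is
  evaluated at t/s.\<close>

lemma coprime_homog_no_common_zero:
  fixes f g :: "'k::field poly"
  assumes "degree f \<le> m" "degree g \<le> n" "f \<noteq> 0" "g \<noteq> 0"
    and cop: "coprime (homog m f) (homog n g)"
    and st: "(s, t) \<noteq> (0, 0)"
  shows "(eval_st (homog m f) s t, eval_st (homog n g) s t) \<noteq> (0, 0)"
proof (cases "s = 0")
  case True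
  then have "t \<noteq> 0" using st by simp
  have "coeff f m \<noteq> 0 \<or> coeff g n \<noteq> 0"
    using coprime_homog(2)[OF assms(1-3) cop] assms(3,4) by (metis leading_coeff_0_iff)
  then show ?thesis using True \<open>t \<noteq> 0\<close> by (auto simp: eval_st_homog_zero)
next
  case False
  obtain u v where uv: "u * f + v * g = 1"
    using coprime_homog(1)[OF assms(1-3) cop] by blast
  have "poly u (t / s) * poly f (t / s) + poly v (t / s) * poly g (t / s) = 1"
    using arg_cong[OF uv, of "\<lambda>p. poly p (t / s)"] by simp
  then have "poly f (t / s) \<noteq> 0 \<or> poly g (t / s) \<noteq> 0" by auto
  then show ?thesis using False assms by (auto simp: eval_st_homog_nonzero)
qed

section \<open>Graded pieces of ideals\<close>

lemma ideal_gen_image: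
  "finite X \<Longrightarrow> ideal_gen (a ` X) = {\<Sum>i\<in>X. c i * a i | c. True}"
  unfolding ideal_gen_def by (rule module.span_image_family[OF module_self])

lemma ideal_gen_pair: "ideal_gen {g, h} = {x * g + y * h | x y. True}"
proof -
  \<comment> \<open>Indexing by \<open>bool\<close> also covers the case
    \<open>g = h\<close>.\<close>
  have eq: "{g, h} = (\<lambda>b. if b then g else h) ` UNIV" by (auto simp: UNIV_bool)
  have sum: "(\<Sum>b\<in>UNIV. c b * (if b then g else h)) = c True * g + c False * h" for c
    by (simp add: UNIV_bool add.commute)
  have "\<exists>c. x * g + y * h = c True * g + c False * h" for x y
    by (rule exI[of _ "\<lambda>b. if b then x else y"]) simp
  then show ?thesis unfolding eq ideal_gen_image[OF finite] sum by blast
qed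

text \<open>Take degree \<open>n\<close> components of \<open>x * g + y * h\<close>. The
  conditionals cover a generator of degree above \<open>n\<close>, as needed when
  \<open>e\<^sub>1 = n + 1\<close> is refuted.\<close>

lemma hom_part_ideal_gen_pair:
  assumes "g \<in> hom_part e" "h \<in> hom_part f" "p \<in> ideal_gen {g, h}" "p \<in> hom_part n"
  obtains x y where "p = (if e \<le> n then hom_comp (n - e) x * g else 0)
    + (if f \<le> n then hom_comp (n - f) y * h else 0)"
proof -
  obtain x y where "p = x * g + y * h" using assms(3) by (auto simp: ideal_gen_pair)
  then have "hom_comp n p = hom_comp n (x * g) + hom_comp n (y * h)" by (simp add: hom_comp_add)
  then show thesis using assms by (intro that[of x y]) (simp add: hom_comp_hom_part hom_comp_mult)
qed

interpretation R: vector_space "\<lambda>c :: 'k::field. Polynomial.smult [:c:]"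
  by (rule vector_space_R)

text \<open>As the generators have degree \<open>n\<close>, only the degree 0 components of the
  coefficients contribute in degree \<open>n\<close>, and these are scalars.\<close>

lemma span_eq_hom_part_ideal_gen:
  assumes "finite X" "\<And>i. i \<in> X \<Longrightarrow> a i \<in> hom_part n"
  shows "R.span (a ` X) = ideal_gen (a ` X) \<inter> hom_part n"
proof (intro equalityI subsetI)
  fix p assume "p \<in> R.span (a ` X)"
  then obtain c where p: "p = (\<Sum>i\<in>X. Polynomial.smult [:c i:] (a i))"
    using assms(1) by (auto simp: R.span_image_family)
  then have "p = (\<Sum>i\<in>X. [:[:c i:]:] * a i)" by simp
  moreover have "p \<in> hom_part n"
    unfolding p by (intro hom_part_sum hom_part_smult assms)
  ultimately show "p \<in> ideal_gen (a ` X) \<inter> hom_part n"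
    using assms(1) by (auto simp: ideal_gen_image simp del: mult_pCons_left)
next
  fix p assume p: "p \<in> ideal_gen (a ` X) \<inter> hom_part n"
  then obtain x where "p = (\<Sum>i\<in>X. x i * a i)"
    using assms(1) by (auto simp: ideal_gen_image)
  then have "hom_comp n p = (\<Sum>i\<in>X. hom_comp n (x i * a i))" by (simp add: hom_comp_sum)
  also have "\<dots> = (\<Sum>i\<in>X. hom_comp 0 (x i) * a i)"
    using assms(2) by (intro sum.cong refl) (simp add: hom_comp_mult[where e = n])
  finally have eq: "p = (\<Sum>i\<in>X. hom_comp 0 (x i) * a i)"
    using p hom_comp_hom_part[of p n n] by simp
  have "hom_comp 0 (x i) * a i \<in> R.span (a ` X)" if i: "i \<in> X" for i
  proof -
    obtain c where "hom_comp 0 (x i) = [:[:c:]:]"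
      using hom_part_0_const hom_comp_in_hom_part by metis
    then have "hom_comp 0 (x i) * a i = Polynomial.smult [:c:] (a i)" by simp
    then show ?thesis by (simp only:) (intro R.span_scale R.span_base imageI i)
  qed
  then show "p \<in> R.span (a ` X)" unfolding eq by (intro R.span_sum)
qed

section \<open>Monomial multiples of two generators\<close>

lemma sum_lessThan_add:
  fixes f :: "nat \<Rightarrow> 'a::comm_monoid_add"
  shows "(\<Sum>i<m + n. f i) = (\<Sum>i<m. f i) + (\<Sum>i<n. f (m + i))"
  by (induction n) (simp_all add: add.assoc)

lemma coeff_sum_monom_if: "coeff (\<Sum>i\<le>m. monom (c i) i) j = (if j \<le> m then c j else 0)"
  by (simp add: coeff_sum)

lemma degree_sum_monom: "degree (\<Sum>i\<le>m. monom (c i) i) \<le> m"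
  by (rule degree_le) (simp add: coeff_sum_monom_if)

lemma homog_sum_monom:
  "homog m (\<Sum>i\<le>m. monom (c i) i) = (\<Sum>i\<le>m. Polynomial.smult [:c i:] (monom (monom 1 (m - i)) i))"
  unfolding homog_def by (intro sum.cong refl) (simp add: coeff_sum_monom_if smult_monom)

text \<open>The order of the indices copies that of the coordinates in
  \<open>scroll_vec\<close>.\<close>

definition scroll_basis ::
  "nat \<Rightarrow> nat \<Rightarrow> 'k::field poly poly \<Rightarrow> 'k poly poly \<Rightarrow> nat \<Rightarrow> 'k poly poly" where
  "scroll_basis p q g h i =
     (if i < p + 1 then monom (monom 1 (p - i)) i * g
      else monom (monom 1 (q - (i - (p + 1)))) (i - (p + 1)) * h)"

text \<open>Grouping a linear combination into two form coefficients reduces spanning and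
  independence to facts about \<open>g\<close> and \<open>h\<close>.\<close>

lemma sum_scroll_basis:
  "(\<Sum>i<(p + 1) + (q + 1). Polynomial.smult [:c i:] (scroll_basis p q g h i)) =
   homog p (\<Sum>i\<le>p. monom (c i) i) * g + homog q (\<Sum>i\<le>q. monom (c (p + 1 + i)) i) * h"
  unfolding sum_lessThan_add Suc_eq_plus1[symmetric] lessThan_Suc_atMost homog_sum_monom
  by (simp add: scroll_basis_def sum_distrib_right)

lemma span_scroll_basis:
  assumes "e \<le> n" "f \<le> n" "g \<in> hom_part e" "h \<in> hom_part f"
  shows "R.span (scroll_basis (n - e) (n - f) g h ` {..<(n - e + 1) + (n - f + 1)}) =
    ideal_gen {g, h} \<inter> hom_part n" (is "R.span ?B = _")
proof (intro equalityI subsetI)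
  fix p assume "p \<in> R.span ?B"
  then obtain F G where p: "p = homog (n - e) F * g + homog (n - f) G * h"
    by (auto simp only: R.span_image_family[OF finite_lessThan] sum_scroll_basis)
  have "homog (n - e) F * g \<in> hom_part n" "homog (n - f) G * h \<in> hom_part n"
    using hom_part_mult[OF homog_in_hom_part[of "n - e" F] assms(3)]
      hom_part_mult[OF homog_in_hom_part[of "n - f" G] assms(4)] assms(1,2) by simp_all
  then show "p \<in> ideal_gen {g, h} \<inter> hom_part n"
    by (auto simp: p ideal_gen_pair intro: hom_part_add)
next
  fix p assume p: "p \<in> ideal_gen {g, h} \<inter> hom_part n"
  obtain x y where xy: "p = hom_comp (n - e) x * g + hom_comp (n - f) y * h"
    using hom_part_ideal_gen_pair[OF assms(3,4) IntD1[OF p] IntD2[OF p]] assms(1,2) by auto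
  obtain F where F: "degree F \<le> n - e" "hom_comp (n - e) x = homog (n - e) F"
    by (rule hom_partE[OF hom_comp_in_hom_part])
  obtain G where G: "degree G \<le> n - f" "hom_comp (n - f) y = homog (n - f) G"
    by (rule hom_partE[OF hom_comp_in_hom_part])
  \<comment> \<open>The coefficients of \<open>F\<close> and \<open>G\<close>, concatenated in the
    order of \<open>scroll_basis\<close>.\<close>
  let ?c = "\<lambda>i. if i < n - e + 1 then coeff F i else coeff G (i - (n - e + 1))"
  have "(\<Sum>i\<le>n - e. monom (?c i) i) = F"
    using F(1) by (subst poly_as_sum_of_monoms'[symmetric, of F "n - e"]) (auto intro!: sum.cong)
  moreover have "(\<Sum>i\<le>n - f. monom (?c (n - e + 1 + i)) i) = G"
    using G(1) by (subst poly_as_sum_of_monoms'[symmetric, of G "n - f"]) (auto intro!: sum.cong)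
  ultimately have "p = (\<Sum>i<(n - e + 1) + (n - f + 1).
      Polynomial.smult [:?c i:] (scroll_basis (n - e) (n - f) g h i))"
    unfolding sum_scroll_basis xy F(2) G(2) by simp
  then show "p \<in> R.span ?B"
    unfolding R.span_image_family[OF finite_lessThan] by (intro CollectI exI[of _ ?c] conjI TrueI)
qed

text \<open>A linear relation is a syzygy in degree \<open>N < m + n\<close>, below the smallest
  nontrivial one.\<close>

lemma scroll_basis_independent:
  fixes f g :: "'k::field poly"
  assumes "degree f \<le> m" "degree g \<le> n" "f \<noteq> 0" "g \<noteq> 0"
    and cop: "coprime (homog m f) (homog n g)"
    and N: "p + m = N" "q + n = N" "N < m + n"
    and z: "(\<Sum>i<(p + 1) + (q + 1).
      Polynomial.smult [:c i:] (scroll_basis p q (homog m f) (homog n g) i)) = 0"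
    and i: "i < (p + 1) + (q + 1)"
  shows "c i = 0"
proof -
  define F G where "F = (\<Sum>i\<le>p. monom (c i) i)" and "G = (\<Sum>i\<le>q. monom (c (p + 1 + i)) i)"
  have deg: "degree F \<le> p" "degree G \<le> q"
    by (simp_all only: F_def G_def degree_sum_monom)
  have "homog p F * homog m f + homog q G * homog n g = 0"
    using z unfolding sum_scroll_basis F_def G_def .
  then have "homog N (F * f + G * g) = 0"
    using deg assms(1,2) by (simp add: homog_mult homog_add N(1,2))
  moreover have "degree (F * f + G * g) \<le> N"
    using degree_mult_le[of F f] degree_mult_le[of G g] deg assms(1,2) N
    by (intro degree_add_le) linarith+
  ultimately have "F * f + G * g = 0" by (simp add: homog_eq_0_iff)
  then have 0: "F = 0 \<and> G = 0"
    using deg N by (intro coprime_homog_syzygy[OF assms(1-4) cop]) auto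
  have "c i = coeff F i" if "i \<le> p"
    using that by (simp only: F_def coeff_sum_monom_if if_True)
  moreover have "c i = coeff G (i - (p + 1))" if "\<not> i \<le> p"
    using that i by (simp only: G_def coeff_sum_monom_if) auto
  ultimately show ?thesis using 0 by (cases "i \<le> p") auto
qed

section \<open>Comparison with the space of all forms\<close>

lemma dim_hom_part: "R.dim (hom_part n :: 'k::field poly poly set) = n + 1"
proof -
  let ?b = "\<lambda>i. monom (monom (1 :: 'k) (n - i)) i"
  have "hom_part n = R.span (?b ` {..n})"
  proof (intro equalityI subsetI)
    fix p :: "'k poly poly" assume "p \<in> hom_part n"
    then obtain f where f: "degree f \<le> n" "p = homog n f" by (rule hom_partE)
    then have "p = (\<Sum>i\<le>n. Polynomial.smult [:coeff f i:] (?b i))"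
      by (simp only: homog_sum_monom[symmetric] poly_as_sum_of_monoms')
    then show "p \<in> R.span (?b ` {..n})" by (auto simp: R.span_image_family)
  next
    fix p assume "p \<in> R.span (?b ` {..n})"
    then show "p \<in> hom_part n"
      by (auto simp only: R.span_image_family[OF finite_atMost] homog_sum_monom[symmetric] homog_in_hom_part)
  qed
  also have "R.dim \<dots> = card {..n}"
  proof (rule R.dim_span_family[OF finite_atMost], intro allI impI ballI)
    fix c i assume "(\<Sum>i\<le>n. Polynomial.smult [:c i:] (?b i)) = 0" "i \<in> {..n}"
    then have "(\<Sum>i\<le>n. monom (c i) i) = 0"
      by (simp only: homog_sum_monom[symmetric] homog_eq_0_iff[OF degree_sum_monom])
    then have "coeff (\<Sum>i\<le>n. monom (c i) i) i = 0" by simp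
    then show "c i = 0" using \<open>i \<in> {..n}\<close> by (simp only: coeff_sum_monom_if) simp
  qed
  finally show ?thesis by simp
qed

text \<open>\<open>homog_combination\<close> wants the full degree in its first polynomial; one of
  \<open>f\<close> and \<open>g\<close> has it, and the second case exchanges them.\<close>

lemma hom_part_subset_ideal_gen:
  fixes f g :: "'k::field poly"
  assumes fg: "degree f \<le> m" "degree g \<le> n" "f \<noteq> 0" "g \<noteq> 0"
    and cop: "coprime (homog m f) (homog n g)" and N: "m + n \<le> N"
  shows "hom_part N \<subseteq> ideal_gen {homog m f, homog n g}"
proof
  fix p :: "'k poly poly" assume "p \<in> hom_part N"
  then obtain h where h: "degree h \<le> N" "p = homog N h" by (rule hom_partE)
  obtain u v where uv: "u * f + v * g = 1"
    using coprime_homog(1)[OF fg(1-3) cop] by blast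
  have "\<exists>x y. h = x * f + y * g \<and> degree x \<le> N - m \<and> degree y \<le> N - n"
  proof (cases "degree f = m")
    case True
    from homog_combination[OF this fg(3,2) uv N h(1)] show ?thesis by blast
  next
    case False
    then have "degree g = n" using coprime_homog(2)[OF fg(1-3) cop] by simp
    moreover have "v * g + u * f = 1" "n + m \<le> N" using uv N by (simp_all add: add.commute)
    ultimately obtain y x where "h = y * g + x * f" "degree y \<le> N - n" "degree x \<le> N - m"
      using homog_combination[of g n f m v u N h] fg h(1) by blast
    then show ?thesis by (metis add.commute)
  qed
  then obtain x y where "h = x * f + y * g" "degree x \<le> N - m" "degree y \<le> N - n" by blast
  then have "p = homog (N - m) x * homog m f + homog (N - n) y * homog n g"
    using h(2) N fg by (simp add: homog_mult homog_add)
  then show "p \<in> ideal_gen {homog m f, homog n g}" by (auto simp: ideal_gen_pair)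
qed

lemma eval_scroll_basis:
  "vec ((p + 1) + (q + 1)) (\<lambda>i. eval_st (scroll_basis p q g h i) s t) =
   scroll_vec p q s t (eval_st g s t) (eval_st h s t)"
  unfolding scroll_vec_def scroll_basis_def
  by (intro eq_vecI) (auto simp: eval_st_mult eval_st_monom)

section \<open>The curve on the scroll\<close>

theorem corollary4p10:
  fixes a :: "nat \<Rightarrow> 'k::field poly poly"
    and d n \<alpha>\<^sub>1 \<alpha>\<^sub>2 :: nat
  assumes "infinite (UNIV :: 'k set)"
    and "d \<ge> 2"
    and "n \<ge> d + 1"
    and "\<forall>j\<le>d. a j \<in> hom_part n"
    and "lin_indep_family d a"
    and "has_mu_type d a (mu_min d n)"
    and "ancestor_partition n (ideal_gen (a ` {..d})) \<alpha>\<^sub>1 \<alpha>\<^sub>2"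
  shows "\<exists>A \<in> carrier_mat (d + 1) (d + 1). invertible_mat A \<and>
    proj_map A ` param_curve d a \<subseteq> rational_normal_scroll (\<alpha>\<^sub>1 - 1) (\<alpha>\<^sub>2 - 1)"
proof -
  let ?I = "ideal_gen (a ` {..d})"
  from assms(7) obtain h\<^sub>1 h\<^sub>2 e\<^sub>1 e\<^sub>2 where
    h: "h\<^sub>1 \<in> hom_part e\<^sub>1" "h\<^sub>1 \<noteq> 0" "h\<^sub>2 \<in> hom_part e\<^sub>2" "h\<^sub>2 \<noteq> 0" and cop: "coprime h\<^sub>1 h\<^sub>2"
    and anc: "is_ancestor_ideal n ?I (ideal_gen {h\<^sub>1, h\<^sub>2})"
    and e: "e\<^sub>1 \<ge> e\<^sub>2" "\<alpha>\<^sub>1 + e\<^sub>1 = n + 1" "\<alpha>\<^sub>2 + e\<^sub>2 = n + 1"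
    unfolding ancestor_partition_def by blast
  let ?J = "ideal_gen {h\<^sub>1, h\<^sub>2}"
  have agrees: "?J \<inter> hom_part m = ?I \<inter> hom_part m" if "n \<le> m" for m
    using anc that by (auto simp: is_ancestor_ideal_def agrees_from_def)
  have d: "{..d} = {..<d + 1}" by auto
  have inda: "\<forall>c. (\<Sum>i<d + 1. Polynomial.smult [:c i:] (a i)) = 0 \<longrightarrow> (\<forall>i\<in>{..<d + 1}. c i = 0)"
    using assms(5) unfolding lin_indep_family_def d R.independent_family_iff[OF finite_lessThan] .
  have span: "R.span (a ` {..<d + 1}) = ?J \<inter> hom_part n"
    using span_eq_hom_part_ideal_gen[of "{..d}" a n] assms(4) agrees[of n] by (simp only: flip: d) auto
  have "R.dim (R.span (a ` {..<d + 1})) = d + 1"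
    by (simp only: R.dim_span_family[OF finite_lessThan inda] card_lessThan)
  then have dim: "R.dim (?J \<inter> hom_part n) = d + 1" by (simp only: span)
  have proper: "\<not> hom_part n \<subseteq> ?J"
  proof
    assume "hom_part n \<subseteq> ?J"
    then have "?J \<inter> hom_part n = hom_part n" by blast
    then show False using dim assms(3) by (simp add: dim_hom_part)
  qed
  \<comment> \<open>The equation \<open>\<alpha>\<^sub>1 + e\<^sub>1 = n + 1\<close> leaves
    \<open>\<alpha>\<^sub>1 = 0\<close> open. Once this is excluded,
    \<open>\<alpha>\<^sub>1 - 1\<close> is a true difference.\<close>
  have "e\<^sub>1 \<le> n"
  proof (rule ccontr)
    assume "\<not> ?thesis"
    then have e1: "e\<^sub>1 = n + 1" using e by simp
    have "h\<^sub>2 dvd a j" if "j \<le> d" for j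
    proof -
      have "a j \<in> ?J \<inter> hom_part n"
        using that by (subst span[symmetric]) (auto intro!: R.span_base)
      then obtain x y where "a j = (if e\<^sub>1 \<le> n then hom_comp (n - e\<^sub>1) x * h\<^sub>1 else 0)
          + (if e\<^sub>2 \<le> n then hom_comp (n - e\<^sub>2) y * h\<^sub>2 else 0)"
        by (metis hom_part_ideal_gen_pair h(1,3) IntD1 IntD2)
      then show ?thesis using e1 by simp
    qed
    then have I: "h\<^sub>2 dvd p" if "p \<in> ?I" for p
      using that by (auto simp: ideal_gen_image intro!: dvd_sum dvd_mult)
    \<comment> \<open>Here the agreement of \<open>?J\<close> with \<open>?I\<close> is used one
      degree above \<open>n\<close>.\<close>
    have "h\<^sub>1 = 1 * h\<^sub>1 + 0 * h\<^sub>2" by simp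
    then have "h\<^sub>1 \<in> ?J \<inter> hom_part e\<^sub>1" using h(1) unfolding ideal_gen_pair by blast
    then have "h\<^sub>1 \<in> ?I" using agrees[of e\<^sub>1] unfolding e1 by auto
    then have "h\<^sub>2 dvd h\<^sub>1" by (rule I)
    then have "h\<^sub>2 dvd 1" using cop by (metis coprime_common_divisor dvd_refl)
    then obtain k where k: "1 = h\<^sub>2 * k" by (elim dvdE)
    have "p \<in> ?J" for p
    proof -
      have "p = 0 * h\<^sub>1 + (p * k) * h\<^sub>2" using k by (simp add: mult.assoc mult.commute[of k])
      then show ?thesis unfolding ideal_gen_pair by blast
    qed
    then show False using proper by blast
  qed
  then have "e\<^sub>2 \<le> n" using e by simp
  obtain f\<^sub>1 where f1: "degree f\<^sub>1 \<le> e\<^sub>1" "h\<^sub>1 = homog e\<^sub>1 f\<^sub>1" using h(1) by (rule hom_partE)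
  obtain f\<^sub>2 where f2: "degree f\<^sub>2 \<le> e\<^sub>2" "h\<^sub>2 = homog e\<^sub>2 f\<^sub>2" using h(3) by (rule hom_partE)
  have nz: "f\<^sub>1 \<noteq> 0" "f\<^sub>2 \<noteq> 0" using h f1 f2 by auto
  note cop' = cop[unfolded f1(2) f2(2)]
  have "n < e\<^sub>1 + e\<^sub>2"
    using hom_part_subset_ideal_gen[OF f1(1) f2(1) nz cop', of n] proper
    unfolding f1(2) f2(2) by fastforce
  define p q where "p = \<alpha>\<^sub>1 - 1" and "q = \<alpha>\<^sub>2 - 1"
  have pq: "p = n - e\<^sub>1" "q = n - e\<^sub>2" "p + e\<^sub>1 = n" "q + e\<^sub>2 = n"
    using e \<open>e\<^sub>1 \<le> n\<close> \<open>e\<^sub>2 \<le> n\<close> by (auto simp: p_def q_def)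
  let ?b = "scroll_basis p q h\<^sub>1 h\<^sub>2" and ?N = "(p + 1) + (q + 1)"
  have indb: "\<forall>c. (\<Sum>i<?N. Polynomial.smult [:c i:] (?b i)) = 0 \<longrightarrow> (\<forall>i\<in>{..<?N}. c i = 0)"
    using scroll_basis_independent[OF f1(1) f2(1) nz cop' pq(3,4) \<open>n < e\<^sub>1 + e\<^sub>2\<close>]
    unfolding f1(2) f2(2) by blast
  have spanb: "R.span (?b ` {..<?N}) = ?J \<inter> hom_part n"
    unfolding pq(1,2) by (rule span_scroll_basis[OF \<open>e\<^sub>1 \<le> n\<close> \<open>e\<^sub>2 \<le> n\<close> h(1,3)])
  have "R.dim (R.span (?b ` {..<?N})) = card {..<?N}"
    by (rule R.dim_span_family[OF finite_lessThan indb])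
  \<comment> \<open>Both numbers are the dimension of the degree \<open>n\<close> part; this is
    \<open>\<alpha>\<^sub>1 + \<alpha>\<^sub>2 = d + 1\<close>.\<close>
  then have N: "?N = d + 1" using dim unfolding spanb by simp
  \<comment> \<open>Row \<open>i\<close> of \<open>A\<close> expands the new basis form
    \<open>?b i\<close> in the \<open>a j\<close>, so \<open>A\<close> takes the values of the
    \<open>a j\<close> at a point to those of the new basis.\<close>
  obtain A where A: "A \<in> carrier_mat (d + 1) (d + 1)" "invertible_mat A"
    and b: "\<And>i. i < d + 1 \<Longrightarrow> ?b i = (\<Sum>j<d + 1. Polynomial.smult [:A $$ (i, j):] (a j))"
    using R.change_of_basis[OF inda indb[unfolded N]] span spanb[unfolded N] by metis
  have "proj_map A (proj_point (vec (d + 1) (\<lambda>j. eval_st (a j) s t))) \<in> rational_normal_scroll p q"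
    if st: "(s, t) \<noteq> (0, 0)" for s t
  proof -
    let ?v = "vec (d + 1) (\<lambda>j. eval_st (a j) s t)"
    have "A *\<^sub>v ?v = vec (d + 1) (\<lambda>i. eval_st (?b i) s t)"
      using A(1) by (intro eq_vecI)
        (auto simp: scalar_prod_def b eval_st_sum eval_st_smult atLeast0LessThan simp del: sum.lessThan_Suc)
    also have "\<dots> = scroll_vec p q s t (eval_st h\<^sub>1 s t) (eval_st h\<^sub>2 s t)"
      unfolding N[symmetric] by (rule eval_scroll_basis)
    finally have Av: "A *\<^sub>v ?v = scroll_vec p q s t (eval_st h\<^sub>1 s t) (eval_st h\<^sub>2 s t)" .
    \<comment> \<open>Nonzero scalars pass through \<open>A\<close>, so the image of a class is
      again a whole class.\<close>
    have "proj_map A (proj_point ?v) = (\<lambda>c. A *\<^sub>v (c \<cdot>\<^sub>v ?v)) ` {c. c \<noteq> 0}"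
      unfolding proj_map_def proj_point_def by auto
    also have "\<dots> = proj_point (A *\<^sub>v ?v)"
      using A(1) by (auto simp: proj_point_def mult_mat_vec[of A "d + 1" "d + 1"])
    finally have "proj_map A (proj_point ?v) = proj_point (A *\<^sub>v ?v)" .
    moreover have "(eval_st h\<^sub>1 s t, eval_st h\<^sub>2 s t) \<noteq> (0, 0)"
      unfolding f1(2) f2(2)
      by (rule coprime_homog_no_common_zero[OF f1(1) f2(1) nz cop' st])
    ultimately show ?thesis
      unfolding Av rational_normal_scroll_def using st by blast
  qed
  then have "proj_map A ` param_curve d a \<subseteq> rational_normal_scroll (\<alpha>\<^sub>1 - 1) (\<alpha>\<^sub>2 - 1)"
    unfolding param_curve_def p_def[symmetric] q_def[symmetric] by blast
  with A show ?thesis by blast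
qed

end
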